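(* Let $f\colon\mathbb{R}\to\mathbb{R}$ be an SD map. Then $f$ is the identity map.
   Context: An SD map on a field $\mathbb{F}$ is a function $f\colon \mathbb{F}\to\mathbb{F}$ such that for all $x \neq y$ in $\mathbb{F}$ one has $f(x)\neq f(y)$ and $f\left(\frac{x+y}{x-y}\right) = \frac{f(x)+f(y)}{f(x)-f(y)}$. No continuity is assumed. *)

theory Defs
  imports Complex_Main
begin

definition SD_map :: "('a::field \<Rightarrow> 'a) \<Rightarrow> bool" where
  "SD_map f \<longleftrightarrow>
     (\<forall>x y. x \<noteq> y \<longrightarrow>
        f x \<noteq> f y \<and> f ((x + y) / (x - y)) = (f x + f y) / (f x - f y))"

end

theory Submission
  imports Defs
begin

text \<open>The functional equation depends on x and y only through their ratio, which makes f
  multiplicative. Computing f 5 in two ways from a = f 2 forces a = 2, and then f fixes the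
  rational numbers. Over the reals, f maps squares to squares, so it preserves positivity and is
  increasing by the functional equation; density of the rationals finishes the proof.\<close>

lemma SD_map_inj:
  assumes "SD_map f" "x \<noteq> y"
  shows "f x \<noteq> f y"
  using assms unfolding SD_map_def by blast

lemma SD_map_eq:
  assumes "SD_map f" "x \<noteq> y"
  shows "f ((x + y) / (x - y)) = (f x + f y) / (f x - f y)"
  using assms unfolding SD_map_def by blast

text \<open>At \<open>y = 0\<close> the argument \<open>(x + y) / (x - y)\<close> is 1 for every
  nonzero \<open>x\<close>, so \<open>(f 1 - 1) * f x\<close> is constant there. Injectivity then
  forces the coefficient to vanish.\<close>

lemma SD_map_zero_one:
  fixes f :: "'a::field_char_0 \<Rightarrow> 'a"
  assumes "SD_map f"
  shows "f 0 = 0" "f 1 = 1"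
proof -
  have eq: "(f 1 - 1) * f x = f 0 * (1 + f 1)" if "x \<noteq> 0" for x
    using SD_map_eq[OF assms that] SD_map_inj[OF assms that] that
    by (simp add: divide_simps) (simp add: algebra_simps)
  have "(f 1 - 1) * (f 1 - f 2) = 0"
    using eq[of 1] eq[of 2] by (simp add: algebra_simps)
  then show 1: "f 1 = 1"
    using SD_map_inj[OF assms, of 1 2] by simp
  show "f 0 = 0"
    using eq[of 1] 1 by simp
qed

text \<open>With \<open>t = x / y\<close>, the pairs \<open>(x, y)\<close> and \<open>(t, 1)\<close>
  give the same argument \<open>(t + 1) / (t - 1)\<close>. Comparing the two values of
  \<open>f\<close> and cross-multiplying isolates \<open>f t\<close>.\<close>

lemma SD_map_divide:
  fixes f :: "'a::field_char_0 \<Rightarrow> 'a"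
  assumes "SD_map f"
  shows "f (x / y) = f x / f y"
\<comment> \<open>The functional equation is silent when \<open>x = y\<close>; for
  \<open>y = 0\<close> the claim rests on division by zero giving 0, together with
  \<open>f 0 = 0\<close>.\<close>
proof (cases "y = 0 \<or> x = y")
  case True
  then show ?thesis
    using SD_map_zero_one[OF assms] SD_map_inj[OF assms, of y 0] by (cases "y = 0") auto
next
  case False
  then have y: "y \<noteq> 0" and xy: "x \<noteq> y" and t: "x / y \<noteq> 1"
    by auto
  have fy: "f y \<noteq> 0"
    using SD_map_inj[OF assms y] SD_map_zero_one[OF assms] by simp
  have fxy: "f x - f y \<noteq> 0"
    using SD_map_inj[OF assms xy] by simp
  have ft: "f (x / y) - 1 \<noteq> 0"
    using SD_map_inj[OF assms t] SD_map_zero_one[OF assms] by simp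
  have "(x + y) / (x - y) = (x / y + 1) / (x / y - 1)"
    using y xy by (simp add: divide_simps)
  then have "(f x + f y) / (f x - f y) = (f (x / y) + 1) / (f (x / y) - 1)"
    using SD_map_eq[OF assms xy] SD_map_eq[OF assms t] SD_map_zero_one[OF assms] by simp
  then have "(f x + f y) * (f (x / y) - 1) = (f (x / y) + 1) * (f x - f y)"
    by (rule frac_eq_eq[OF fxy ft, THEN iffD1])
  then have "2 * (f (x / y) * f y) = 2 * f x"
    by (simp add: algebra_simps)
  then show ?thesis
    using fy by (simp add: eq_divide_eq)
qed

lemma SD_map_mult:
  fixes f :: "'a::field_char_0 \<Rightarrow> 'a"
  assumes "SD_map f"
  shows "f (x * y) = f x * f y"
  using SD_map_divide[OF assms, of x "1 / y"] SD_map_divide[OF assms, of 1 y]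
    SD_map_zero_one[OF assms] by simp

text \<open>The pair \<open>(x, - x)\<close> has sum 0, so \<open>f 0 = 0\<close> makes the
  numerator \<open>f x + f (- x)\<close> vanish.\<close>

lemma SD_map_minus:
  fixes f :: "'a::field_char_0 \<Rightarrow> 'a"
  assumes "SD_map f"
  shows "f (- x) = - f x"
proof (cases "x = 0")
  case False
  then have "x \<noteq> - x"
    by (simp add: eq_neg_iff_add_eq_0 flip: mult_2)
  then show ?thesis
    using SD_map_eq[OF assms, of x "- x"] SD_map_inj[OF assms, of x "- x"]
      SD_map_zero_one[OF assms] by (simp add: eq_neg_iff_add_eq_0 add.commute)
qed (simp add: SD_map_zero_one[OF assms])

text \<open>The two ways to reach \<open>f 5\<close> are 5 = (3 + 2) / (3 - 2) and 5 / 3 = (4 + 1) /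
  (4 - 1), while 3 = (2 + 1) / (2 - 1) ties \<open>f 3\<close> to \<open>a\<close>.\<close>

lemma SD_map_two:
  fixes f :: "'a::field_char_0 \<Rightarrow> 'a"
  assumes "SD_map f"
  shows "f 2 = 2"
proof -
  note f01 = SD_map_zero_one[OF assms]
  define a where "a = f 2"
  have a0: "a \<noteq> 0" and a1: "a - 1 \<noteq> 0"
    using SD_map_inj[OF assms, of 2 0] SD_map_inj[OF assms, of 2 1] f01
    by (simp_all add: a_def)
  have f4: "f 4 = a * a"
    using SD_map_mult[OF assms, of 2 2] by (simp add: a_def)
  have a2: "a * a - 1 \<noteq> 0"
    using SD_map_inj[OF assms, of 4 1] f01 f4 by simp
  have f3: "f 3 * (a - 1) = a + 1"
    using SD_map_eq[OF assms, of 2 1] a1 f01 by (simp add: a_def)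
  have f30: "f 3 \<noteq> 0"
    using SD_map_inj[OF assms, of 3 0] f01 by simp
  have d: "f 3 - a \<noteq> 0"
    using SD_map_inj[OF assms, of 3 2] by (simp add: a_def)
  have i: "f 5 * (f 3 - a) = f 3 + a"
    using SD_map_eq[OF assms, of 3 2] d by (simp add: a_def)
  have "f 5 / f 3 = (a * a + 1) / (a * a - 1)"
    using SD_map_eq[OF assms, of 4 1] SD_map_divide[OF assms, of 5 3] f01 f4 by simp
  then have ii: "f 5 * (a * a - 1) = (a * a + 1) * f 3"
    by (rule frac_eq_eq[OF f30 a2, THEN iffD1])
  have "a * a - 1 = (a + 1) * (a - 1)"
    by (simp add: algebra_simps)
  \<comment> \<open>Trading \<open>a + 1\<close> for \<open>f 3 * (a - 1)\<close> lets a factor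
    \<open>f 3\<close> cancel below, leaving an equation linear in \<open>f 3\<close>.\<close>
  then have sq: "a * a - 1 = f 3 * (a - 1) * (a - 1)"
    by (simp only: f3)
  have "f 3 * ((a * a + 1) * (f 3 - a)) = f 5 * (a * a - 1) * (f 3 - a)"
    unfolding ii by (simp only: ac_simps)
  also have "\<dots> = f 5 * (f 3 - a) * (a * a - 1)"
    by (simp only: ac_simps)
  also have "\<dots> = f 3 * ((f 3 + a) * (a - 1) * (a - 1))"
    unfolding i sq by (simp only: ac_simps)
  finally have "(a * a + 1) * (f 3 - a) = (f 3 + a) * (a - 1) * (a - 1)"
    using f30 by simp
  then have "(2 * a) * f 3 = (2 * a) * (a * a - a + 1)"
    by (simp add: algebra_simps)
  then have "f 3 = a * a - a + 1"
    using a0 by simp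
  with f3 have "(a * a - a + 1) * (a - 1) = a + 1"
    by simp
  then have "(a * a + 1) * (a - 2) = 0"
    by (simp add: algebra_simps)
  \<comment> \<open>The field need not be ordered, so -1 might be a square; but \<open>a * a\<close>
    is \<open>f 4\<close>, which differs from \<open>f (-1) = -1\<close>.\<close>
  moreover have "a * a + 1 \<noteq> 0"
    using SD_map_inj[OF assms, of 4 "-1"] f4 f01 SD_map_minus[OF assms, of 1]
    by (simp add: eq_neg_iff_add_eq_0)
  ultimately show ?thesis
    by (simp add: a_def)
qed

text \<open>The pair \<open>(n + 1, 1)\<close> gives the argument \<open>(n + 2) / n\<close>, so
  \<open>f (n + 2)\<close> follows from the two preceding values. At \<open>n = 0\<close> the
  denominator vanishes, which is why \<open>f 2\<close> is computed separately.\<close>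

lemma SD_map_of_nat:
  fixes f :: "'a::field_char_0 \<Rightarrow> 'a"
  assumes "SD_map f"
  shows "f (of_nat n) = of_nat n"
proof (induction n rule: induct_nat_012)
  case 0
  then show ?case by (simp add: SD_map_zero_one[OF assms])
next
  case 1
  then show ?case by (simp add: SD_map_zero_one[OF assms])
next
  case (ge2 n)
  show ?case
  proof (cases "n = 0")
    case True
    then show ?thesis by (simp add: SD_map_two[OF assms])
  next
    case False
    then have ne: "(1 + of_nat n :: 'a) \<noteq> 1" by simp
    have "f (of_nat (Suc (Suc n))) / of_nat n = f (of_nat (Suc (Suc n)) / of_nat n)"
      using ge2 by (simp add: SD_map_divide[OF assms])
    also have "\<dots> = of_nat (Suc (Suc n)) / of_nat n"
      using SD_map_eq[OF assms ne] ge2 SD_map_zero_one[OF assms]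
      by (simp add: add.commute add.left_commute)
    finally show ?thesis
      using False by simp
  qed
qed

lemma SD_map_Rats:
  fixes f :: "'a::field_char_0 \<Rightarrow> 'a"
  assumes "SD_map f" "x \<in> \<rat>"
  shows "f x = x"
proof -
  have int: "f (of_int k) = of_int k" for k
    by (cases k rule: int_cases2)
      (simp_all add: SD_map_of_nat[OF assms(1)] SD_map_minus[OF assms(1)])
  from assms(2) obtain p q where "x = of_int p / of_int q"
    by (auto elim: Rats_cases')
  then show ?thesis
    by (simp add: SD_map_divide[OF assms(1)] int)
qed

lemma SD_map_real_pos:
  fixes f :: "real \<Rightarrow> real"
  assumes "SD_map f" "x > 0"
  shows "f x > 0"
proof -
  have "f x = f (sqrt x) * f (sqrt x)"
    using assms(2) SD_map_mult[OF assms(1), of "sqrt x" "sqrt x"] by simp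
  moreover have "f x \<noteq> 0"
    using SD_map_inj[OF assms(1), of x 0] SD_map_zero_one[OF assms(1)] assms(2) by simp
  ultimately show ?thesis
    by (metis not_square_less_zero linorder_neqE_linordered_idom)
qed

text \<open>The argument \<open>(x + y) / (x - y)\<close> is positive, hence so is its image; a
  positive numerator \<open>f x + f y\<close> then forces a positive denominator.\<close>

lemma SD_map_real_less:
  fixes f :: "real \<Rightarrow> real"
  assumes "SD_map f" "0 < y" "y < x"
  shows "f y < f x"
proof -
  have "0 < f ((x + y) / (x - y))"
    using assms by (intro SD_map_real_pos[OF assms(1)]) auto
  then have "0 < (f x + f y) / (f x - f y)"
    using SD_map_eq[OF assms(1), of x y] assms(3) by simp
  moreover have "f x + f y > 0"
    using assms by (intro add_pos_pos SD_map_real_pos[OF assms(1)]) auto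
  ultimately show ?thesis
    by (simp add: zero_less_divide_iff)
qed

theorem theorem3p6:
  fixes f :: "real \<Rightarrow> real"
  assumes "SD_map f"
  shows "f = id"
proof -
  have pos: "f x = x" if x: "x > 0" for x
  proof (rule ccontr)
    assume "f x \<noteq> x"
    then consider "f x < x" | "x < f x" by linarith
    then show False
    proof cases
      case 1
      then obtain q where q: "q \<in> \<rat>" "f x < q" "q < x"
        using Rats_dense_in_real by blast
      \<comment> \<open>Monotonicity is known only for positive arguments; here
        \<open>q > f x > 0\<close> supplies this, and \<open>q < x\<close> yields
        \<open>q = f q < f x\<close>, a contradiction.\<close>
      with SD_map_real_pos[OF assms x] SD_map_real_less[OF assms, of q x]
        SD_map_Rats[OF assms q(1)] show False by linarith
    next
      case 2
      then obtain q where q: "q \<in> \<rat>" "x < q" "q < f x"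
        using Rats_dense_in_real by blast
      with x SD_map_real_less[OF assms, of x q] SD_map_Rats[OF assms q(1)]
      show False by linarith
    qed
  qed
  have "f x = x" for x
    using pos[of x] pos[of "- x"] SD_map_minus[OF assms, of x] SD_map_zero_one[OF assms]
    by (cases x "0::real" rule: linorder_cases) auto
  then show ?thesis by auto
qed

end
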